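(* Let $N\ge 1$, let $a_k:\mathbb{Z}\to\mathbb{C}$ ($k=1,2,3$) be arbitrary functions and $b$ a constant. Let $\varphi_i=\varphi_{i,l_1,l_2,l_3}^{m,s}$ ($i=1,\dots,N$) be arbitrary functions on $\mathbb{Z}^5$ satisfying the linear relations $$\frac{\varphi_i-\varphi_{i,l_k-1}}{a_k(l_k-1)}=\varphi_i^{s+1}\quad(k=1,2,3),\qquad \frac{\varphi_i-\varphi_i^{m-1}}{b}=-\varphi_i^{s-1}.$$ Let $\sigma=\sigma_{l_1,l_2,l_3}^{m,s}$ be the $N\times N$ Casorati determinant $\sigma=\det\left(\varphi_i^{s+j-1}\right)_{i,j=1,\dots,N}$. Then $$\tau=\left[\prod_{k=1}^3\ \prod_{j_k}^{l_k-1}(1+a_k(j_k)b)^{m}\,a_k(j_k)^s\right]b^{-ms}\,\sigma$$ satisfies the bilinear equations $$\tau_{l_i+1}^{m+1}\,\tau-\tau_{l_i+1}\,\tau^{m+1}=\tau_{l_i+1}^{s+1}\,\tau^{m+1,s-1}\qquad(i=1,2,3).$$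
   Context: Notation: only shifted independent variables are displayed. E.g. $\tau=\tau_{l_1,l_2,l_3}^{m,s}$, $\tau_{l_i+1}^{m+1}$ is $\tau$ with $l_i$ and $m$ each raised by one, $\tau^{m+1,s-1}=\tau_{l_1,l_2,l_3}^{m+1,s-1}$, $\varphi_{i,l_k-1}$ is $\varphi_i$ with $l_k$ lowered by one, $\varphi_i^{s+j-1}$ is $\varphi_i$ with $s$ replaced by $s+j-1$. The symbol $\prod_{j}^{l-1}g(j)$ denotes an indefinite product with an arbitrary fixed lower limit, i.e. a function $G(l)$ with $G(l+1)=g(l)G(l)$ (e.g. $G(l)=\prod_{j=0}^{l-1}g(j)$ for $l\ge0$, extended to $l<0$ by the recursion); $\prod_j^{l-1}(1+a(j)b)^m a(j)^s$ means the $m$-th power of the indefinite product of $1+a(j)b$ times the $s$-th power of that of $a(j)$. The quantities $b$, $a_k(l)$, $1+a_k(l)b$ are understood to be nonzero so that all expressions are defined. *)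

theory Defs
  imports Complex_Main "HOL-Library.Numeral_Type" "Jordan_Normal_Form.Determinant"
begin

(* The index type 3 has exactly three elements 1, 2, 3 (with 3 = 0), so a function of type
   3 => int is a point of Z^3, and l(k := l k + 1) raises l_k by one. *)

type_synonym lattice_fun = "(3 \<Rightarrow> int) \<Rightarrow> int \<Rightarrow> int \<Rightarrow> complex"

(* G is an indefinite product of g: the lower limit, i.e. the normalisation of G, is left open.
   Only the zero solution of the recursion is excluded, because powers of G with negative
   exponents have to make sense; for nowhere vanishing g, such a G vanishes nowhere. *)
definition indefinite_product :: "(int \<Rightarrow> complex) \<Rightarrow> (int \<Rightarrow> complex) \<Rightarrow> bool" where
  "indefinite_product g G \<longleftrightarrow> (\<forall>l. G (l + 1) = g l * G l) \<and> (\<exists>l. G l \<noteq> 0)"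

(* The functions phi_1, ..., phi_N are numbered from 1, matrix entries from 0; hence
   Suc i, and s + j in place of s + j - 1. *)
definition casorati :: "nat \<Rightarrow> (nat \<Rightarrow> lattice_fun) \<Rightarrow> lattice_fun" where
  "casorati N \<phi> l m s = det (mat N N (\<lambda>(i, j). \<phi> (Suc i) l m (s + int j)))"

(* P k and Q k are indefinite products of 1 + a_k b and of a_k, respectively. *)
definition tau ::
  "nat \<Rightarrow> (3 \<Rightarrow> int \<Rightarrow> complex) \<Rightarrow> (3 \<Rightarrow> int \<Rightarrow> complex) \<Rightarrow> complex \<Rightarrow> (nat \<Rightarrow> lattice_fun) \<Rightarrow> lattice_fun" where
  "tau N P Q b \<phi> l m s =
     (\<Prod>k\<in>UNIV. P k (l k) powi m * Q k (l k) powi s) * b powi (- (m * s)) * casorati N \<phi> l m s"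

end

(* Write f, psi, chi, phi for the functions phi_i at (l_i + 1, m + 1), (l_i + 1, m), (l_i, m + 1),
   (l_i, m). The linear relations say psi_t = f_t + b f_{t-1}, chi_t = f_t - a f_{t+1} and
   phi_t = psi_t - a psi_{t+1} = chi_t + b chi_{t-1}, with t the value of s. By elementary
   operations every Casorati determinant in the equation becomes, up to a factor, one of the form
   |x phi_{s+1} ... phi_{s+N-2} y| with x, y among phi_s, chi_s, phi_{s+N-1}, psi_{s+N-1}, and the
   bilinear equation for sigma, (1 + a b) f phi - psi chi = a b psi^{s+1} chi^{s-1}, is a
   three-term Pluecker relation. The prefactor of tau absorbs the coefficients 1 + a b and a b. *)

theory Submission
  imports Defs
begin

section \<open>Determinants as functions of their rows: Cramer's rule and a Pluecker
  relation\<close>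

text \<open>With the rows given by a function, replacing a row is a function update
  \<open>c(k := x)\<close>.\<close>

definition row_det :: "nat \<Rightarrow> (nat \<Rightarrow> nat \<Rightarrow> 'a::comm_ring_1) \<Rightarrow> 'a" where
  "row_det n c = det (mat n n (\<lambda>(i, j). c i j))"

lemma row_det_cong:
  assumes "\<And>i j. i < n \<Longrightarrow> j < n \<Longrightarrow> c i j = c' i j"
  shows "row_det n c = row_det n c'"
proof -
  have "mat n n (\<lambda>(i, j). c i j) = mat n n (\<lambda>(i, j). c' i j)"
    by (rule eq_matI) (use assms in auto)
  then show ?thesis by (simp add: row_det_def)
qed

text \<open>Transposing turns shifts of \<open>s\<close> into rows, so that the linear relations
  become row operations.\<close>

lemma casorati_eq_row_det:
  "casorati N \<phi> l m s = row_det N (\<lambda>j i. \<phi> (Suc i) l m (s + int j))"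
proof -
  let ?A = "mat N N (\<lambda>(i, j). \<phi> (Suc i) l m (s + int j))"
  have "mat N N (\<lambda>(j, i). \<phi> (Suc i) l m (s + int j)) = transpose_mat ?A"
    by (rule eq_matI) auto
  then show ?thesis
    by (simp add: casorati_def row_det_def det_transpose[of ?A N])
qed

text \<open>The cofactors along row \<open>k\<close> do not involve row \<open>k\<close>, so they
  are those of \<open>c\<close> for every \<open>x\<close>; this makes linearity in one row
  explicit.\<close>

lemma row_det_expand_row:
  assumes "k < n"
  shows "row_det n (c(k := x)) = (\<Sum>j<n. x j * cofactor (mat n n (\<lambda>(i, j). c i j)) k j)"
proof -
  let ?A = "mat n n (\<lambda>(i, j). (c(k := x)) i j)"
  have "mat_delete ?A k j = mat_delete (mat n n (\<lambda>(i, j). c i j)) k j" for j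
    unfolding mat_delete_def by (rule eq_matI) auto
  moreover have "row_det n (c(k := x)) = (\<Sum>j<n. ?A $$ (k, j) * cofactor ?A k j)"
    unfolding row_det_def by (rule laplace_expansion_row) (use assms in auto)
  ultimately show ?thesis
    using assms by (simp add: cofactor_def)
qed

text \<open>After exchanging the two sums, the inner one is an entry of the adjugate times the
  matrix, that is, of the determinant times the identity.\<close>

lemma row_det_cramer:
  assumes "j < n"
  shows "(\<Sum>i<n. row_det n (c(i := u)) * c i j) = row_det n c * u j"
proof -
  let ?A = "mat n n (\<lambda>(i, j). c i j)"
  have A: "?A \<in> carrier_mat n n" by simp
  have adj: "(\<Sum>i<n. cofactor ?A i r * c i j) = (if r = j then row_det n c else 0)" if "r < n" for r
  proof -
    have "(adj_mat ?A * ?A) $$ (r, j) = (\<Sum>i<n. cofactor ?A i r * c i j)"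
      using that assms adj_mat(1)[OF A]
      by (simp add: scalar_prod_def atLeast0LessThan) (simp add: adj_mat_def)
    moreover have "(adj_mat ?A * ?A) $$ (r, j) = (if r = j then row_det n c else 0)"
      using that assms by (simp add: adj_mat(3)[OF A] row_det_def)
    ultimately show ?thesis by simp
  qed
  have "(\<Sum>i<n. row_det n (c(i := u)) * c i j) = (\<Sum>i<n. \<Sum>r<n. u r * (cofactor ?A i r * c i j))"
    by (rule sum.cong) (simp_all add: row_det_expand_row sum_distrib_right mult.assoc)
  also have "\<dots> = (\<Sum>r<n. u r * (\<Sum>i<n. cofactor ?A i r * c i j))"
    by (subst sum.swap) (simp add: sum_distrib_left)
  also have "\<dots> = (\<Sum>r<n. if r = j then u r * row_det n c else 0)"
    by (rule sum.cong) (simp_all add: adj)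
  also have "\<dots> = row_det n c * u j"
    using assms by (simp add: mult.commute)
  finally show ?thesis .
qed

lemma row_det_identical_rows:
  assumes "i < n" "k < n" "i \<noteq> k" "c i = c k"
  shows "row_det n c = 0"
  unfolding row_det_def
  by (rule det_identical_rows[OF _ assms(3,1,2)]) (use assms in auto)

(* Expand the row u in the rows of c by Cramer's rule; only rows k and h survive once u is
   placed next to all the other rows of c. *)
lemma row_det_pluecker:
  assumes "k < n" "h < n" "k \<noteq> h"
  shows "row_det n c * row_det n (c(k := u, h := v))
    = row_det n (c(k := u)) * row_det n (c(h := v))
      + row_det n (c(h := u)) * row_det n (c(k := c h, h := v))"
proof -
  define g where "g = cofactor (mat n n (\<lambda>(i, j). (c(h := v)) i j)) k"
  have R: "row_det n (c(k := x, h := v)) = (\<Sum>j<n. x j * g j)" for x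
    using row_det_expand_row[of k n "c(h := v)" x] assms
    by (simp add: g_def fun_upd_twist)
  have "row_det n c * row_det n (c(k := u, h := v)) = (\<Sum>j<n. row_det n c * u j * g j)"
    by (simp add: R sum_distrib_left mult.assoc)
  also have "\<dots> = (\<Sum>j<n. \<Sum>i<n. row_det n (c(i := u)) * (c i j * g j))"
    by (rule sum.cong)
      (simp_all add: row_det_cramer[of _ n c u, symmetric] sum_distrib_right mult.assoc)
  also have "\<dots> = (\<Sum>i<n. row_det n (c(i := u)) * row_det n (c(k := c i, h := v)))"
    by (subst sum.swap) (simp add: R sum_distrib_left)
  also have "\<dots> = (\<Sum>i\<in>{k, h}. row_det n (c(i := u)) * row_det n (c(k := c i, h := v)))"
  proof (rule sum.mono_neutral_right)
    show "\<forall>i\<in>{..<n} - {k, h}. row_det n (c(i := u)) * row_det n (c(k := c i, h := v)) = 0"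
    proof
      fix i assume i: "i \<in> {..<n} - {k, h}"
      have "row_det n (c(k := c i, h := v)) = 0"
        by (rule row_det_identical_rows[of i n k]) (use assms i in auto)
      then show "row_det n (c(i := u)) * row_det n (c(k := c i, h := v)) = 0" by simp
    qed
  qed (use assms in auto)
  also have "\<dots> = row_det n (c(k := u)) * row_det n (c(h := v))
      + row_det n (c(h := u)) * row_det n (c(k := c h, h := v))"
    using assms by simp
  finally show ?thesis .
qed

section \<open>Elementary row operations and the bilinear equation for Casorati determinants\<close>

lemma row_det_scale_row:
  assumes "k < n"
  shows "row_det n (c(k := \<lambda>j. a * c k j)) = a * row_det n c"
  using row_det_expand_row[OF assms, of c "\<lambda>j. a * c k j"]
    row_det_expand_row[OF assms, of c "c k"]
  by (simp add: sum_distrib_left mult.assoc)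

lemma row_det_add_row:
  assumes "k < n" "h < n" "h \<noteq> k"
  shows "row_det n (c(k := \<lambda>j. c k j + a * c h j)) = row_det n c"
proof -
  have "row_det n (c(k := \<lambda>j. c k j + a * c h j))
      = row_det n (c(k := c k)) + a * row_det n (c(k := c h))"
    unfolding row_det_expand_row[OF assms(1)]
    by (simp add: sum_distrib_left sum.distrib algebra_simps)
  moreover have "row_det n (c(k := c h)) = 0"
    by (rule row_det_identical_rows[of h n k]) (use assms in auto)
  ultimately show ?thesis by simp
qed

lemma row_det_add_next_rows:
  assumes "K < n"
    and "\<And>i j. i < K \<Longrightarrow> c' i j = c i j + a * c (Suc i) j"
    and "\<And>i j. K \<le> i \<Longrightarrow> i < n \<Longrightarrow> c' i j = c i j"
  shows "row_det n c' = row_det n c"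
  using assms
proof (induction K arbitrary: c')
  case 0
  then show ?case by (intro row_det_cong) auto
next
  case (Suc K)
  \<comment> \<open>The last modified row is restored first: its successor is still a row of
    \<open>c\<close>.\<close>
  let ?d = "c'(K := c K)"
  have "row_det n c' = row_det n (?d(K := \<lambda>j. ?d K j + a * ?d (Suc K) j))"
    using Suc.prems by (intro row_det_cong) auto
  also have "\<dots> = row_det n ?d"
    using Suc.prems by (intro row_det_add_row) auto
  also have "\<dots> = row_det n c"
    using Suc.prems by (intro Suc.IH) (auto simp: le_less_Suc_eq Suc_le_eq)
  finally show ?case .
qed

lemma row_det_add_previous_rows:
  assumes "\<And>i j. Suc i < n \<Longrightarrow> c' (Suc i) j = c (Suc i) j + a * c i j"
    and "\<And>j. c' 0 j = c 0 j"
  shows "row_det n c' = row_det n c"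
proof -
  \<comment> \<open>Rows are restored from the top down, since row \<open>K\<close> of
    \<open>c'\<close> differs from that of \<open>c\<close> by a multiple of row
    \<open>K - 1\<close> of \<open>c\<close>, which has to be in place already.\<close>
  have "row_det n (\<lambda>i. if i < K then c i else c' i) = row_det n c'" if "K \<le> n" for K
    using that
  proof (induction K)
    case (Suc K)
    let ?d = "\<lambda>i. if i < Suc K then c i else c' i"
    have "row_det n ?d = row_det n (\<lambda>i. if i < K then c i else c' i)"
    proof (cases K)
      case 0
      then show ?thesis using assms by (intro row_det_cong) (auto simp: less_Suc_eq)
    next
      case (Suc K')
      have "row_det n (\<lambda>i. if i < K then c i else c' i)
          = row_det n (?d(K := \<lambda>j. ?d K j + a * ?d K' j))"
        using Suc \<open>Suc K \<le> n\<close> assms by (intro row_det_cong) (auto simp: less_Suc_eq)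
      also have "\<dots> = row_det n ?d"
        using Suc \<open>Suc K \<le> n\<close> by (intro row_det_add_row) auto
      finally show ?thesis by simp
    qed
    then show ?case using Suc by simp
  qed simp
  from this[of n] have "row_det n (\<lambda>i. if i < n then c i else c' i) = row_det n c'" by simp
  moreover have "row_det n (\<lambda>i. if i < n then c i else c' i) = row_det n c"
    by (rule row_det_cong) simp
  ultimately show ?thesis by simp
qed

lemma row_det_move_row_to_front:
  assumes "k < n"
  shows "row_det n (\<lambda>i. if i = 0 then c k else if i \<le> k then c (i - 1) else c i)
    = (-1) ^ k * row_det n c"
proof -
  let ?A = "mat n n (\<lambda>(i, j). c i j)"
  have A: "?A \<in> carrier_mat n n" by simp
  have "swap_row_to_front ?A k
      = mat n n (\<lambda>(i, j). (if i = 0 then c k else if i \<le> k then c (i - 1) else c i) j)"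
    unfolding swap_row_to_front_result[OF A assms] by (rule eq_matI) (use assms in auto)
  then show ?thesis
    using swap_row_to_front_det[OF A assms] by (simp add: row_det_def)
qed

(* The matrix form needs n >= 2 (distinct first and last rows); n = 1 is a polynomial identity. *)
lemma casorati_bilinear:
  fixes f :: "int \<Rightarrow> nat \<Rightarrow> 'a::comm_ring_1" and a b :: 'a
  assumes "n \<ge> 1"
  defines "\<psi> \<equiv> \<lambda>t i. f t i + b * f (t - 1) i"
    and "\<chi> \<equiv> \<lambda>t i. f t i - a * f (t + 1) i"
  defines "\<phi> \<equiv> \<lambda>t i. \<chi> t i + b * \<chi> (t - 1) i"
  defines "D \<equiv> \<lambda>(g :: int \<Rightarrow> nat \<Rightarrow> 'a) t. row_det n (\<lambda>j. g (t + int j))"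
  shows "(1 + a * b) * D f t * D \<phi> t - D \<psi> t * D \<chi> t = a * b * D \<psi> (t + 1) * D \<chi> (t - 1)"
proof (cases "n = 1")
  case True
  have D: "D g t = g t 0" for g t
    by (simp add: D_def True row_det_def det_single)
  show ?thesis
    unfolding D \<phi>_def \<psi>_def \<chi>_def by (simp add: algebra_simps)
next
  case False
  define h where "h = n - 1"
  have h: "n = Suc h" "h < n" "0 < h" using assms False by (auto simp: h_def)
  \<comment> \<open>All determinants in the equation are compared with this matrix, changed only in
    its first row and its last row, which belongs to the shift \<open>p\<close>.\<close>
  define c where "c = (\<lambda>j. \<phi> (t + int j))"
  define p where "p = t + int h"
  have \<phi>\<psi>: "\<phi> x i = \<psi> x i - a * \<psi> (x + 1) i" for x i
    by (simp add: \<phi>_def \<psi>_def \<chi>_def algebra_simps)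
  have Dc: "D \<phi> t = row_det n c" by (simp add: D_def c_def)
  \<comment> \<open>All rows but the last are differences of neighbouring \<open>\<psi>\<close>
    rows; the next lines for \<open>\<chi>\<close> fix the first row instead.\<close>
  have D\<psi>: "D \<psi> t = row_det n (c(h := \<psi> p))"
    unfolding D_def
    by (rule sym, rule row_det_add_next_rows[of h _ _ _ "- a"])
      (auto simp: h c_def p_def \<phi>\<psi> algebra_simps le_less_Suc_eq)
  have D\<chi>: "D \<chi> t = row_det n (c(0 := \<chi> t))"
    unfolding D_def
    by (rule sym, rule row_det_add_previous_rows[of _ _ _ b])
      (auto simp: c_def \<phi>_def algebra_simps)
  have Df: "(1 + a * b) * D f t = row_det n (c(0 := \<chi> t, h := \<psi> p))"
  proof -
    define d where "d = (\<lambda>j. if j < h then \<chi> (t + int j) else f (t + int j))"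
    have "D f t = row_det n d"
      unfolding D_def
      by (rule sym, rule row_det_add_next_rows[of h _ _ _ "- a"])
        (auto simp: h d_def \<chi>_def algebra_simps)
    then have "(1 + a * b) * D f t = row_det n (d(h := \<lambda>j. (1 + a * b) * d h j))"
      by (simp add: row_det_scale_row h)
    \<comment> \<open>This is where \<open>1 + a * b\<close> comes from: in the last row, (1 + a b)
      f_p + b chi_{p-1} = f_p + b f_{p-1} = psi_p.\<close>
    also have "\<dots> = row_det n (c(0 := \<chi> t, h := \<psi> p))"
      by (rule sym, rule row_det_add_previous_rows[of _ _ _ b])
        (use h in \<open>auto simp: c_def d_def p_def \<phi>_def \<psi>_def \<chi>_def algebra_simps\<close>)
    finally show ?thesis .
  qed
  have D\<psi>1: "a * D \<psi> (t + 1) = (-1) ^ (h - 1) * row_det n (c(0 := c h, h := \<psi> p))"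
  proof -
    define d where "d = (\<lambda>j. if j < h then \<phi> (t + 1 + int j) else \<psi> (t + 1 + int j))"
    have "D \<psi> (t + 1) = row_det n d"
      unfolding D_def
      by (rule sym, rule row_det_add_next_rows[of h _ _ _ "- a"])
        (auto simp: h d_def \<phi>\<psi> algebra_simps)
    then have "a * D \<psi> (t + 1) = row_det n (d(h := \<lambda>j. a * d h j))"
      by (simp add: row_det_scale_row h)
    \<comment> \<open>Row \<open>h - 1\<close> is phi_p, and phi_p + a psi_{p+1} = psi_p.\<close>
    also have "\<dots> = row_det n (d(h := \<psi> p))"
    proof -
      let ?e = "d(h := \<lambda>j. a * d h j)"
      have "row_det n (d(h := \<psi> p)) = row_det n (?e(h := \<lambda>j. ?e h j + 1 * ?e (h - 1) j))"
        using h by (intro row_det_cong) (auto simp: d_def p_def \<phi>\<psi> algebra_simps of_nat_diff)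
      also have "\<dots> = row_det n ?e"
        using h by (intro row_det_add_row) auto
      finally show ?thesis by simp
    qed
    finally have *: "a * D \<psi> (t + 1) = row_det n (d(h := \<psi> p))" .
    \<comment> \<open>The rows agree up to moving phi_p from position \<open>h - 1\<close> to the
      front.\<close>
    have "row_det n (c(0 := c h, h := \<psi> p)) = (-1) ^ (h - 1) * row_det n (d(h := \<psi> p))"
      using h
      by (subst row_det_move_row_to_front[symmetric])
        (auto intro!: row_det_cong simp: c_def d_def of_nat_diff algebra_simps)
    with * show ?thesis by (simp flip: power_mult_distrib mult.assoc)
  qed
  have D\<chi>1: "b * D \<chi> (t - 1) = (-1) ^ (h - 1) * row_det n (c(h := \<chi> t))"
  proof -
    define d where "d = (\<lambda>j. if j = 0 then \<chi> (t - 1) else \<phi> (t - 1 + int j))"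
    have "D \<chi> (t - 1) = row_det n d"
      unfolding D_def
      by (rule sym, rule row_det_add_previous_rows[of _ _ _ b])
        (auto simp: d_def \<phi>_def algebra_simps)
    then have "- b * D \<chi> (t - 1) = row_det n (d(0 := \<lambda>j. - b * d 0 j))"
      by (simp only: row_det_scale_row h)
    \<comment> \<open>Row 1 is phi_t, and phi_t - b chi_{t-1} = chi_t; hence the scaling by
      \<open>- b\<close>.\<close>
    also have "\<dots> = row_det n (d(0 := \<chi> t))"
    proof -
      let ?e = "d(0 := \<lambda>j. - b * d 0 j)"
      have "row_det n (d(0 := \<chi> t)) = row_det n (?e(0 := \<lambda>j. ?e 0 j + 1 * ?e 1 j))"
        by (intro row_det_cong) (auto simp: d_def \<phi>_def algebra_simps)
      also have "\<dots> = row_det n ?e"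
        using h by (intro row_det_add_row) auto
      finally show ?thesis by simp
    qed
    also have "\<dots> = (-1) ^ h * row_det n (c(h := \<chi> t))"
      using h
      by (subst row_det_move_row_to_front[symmetric])
        (auto intro!: row_det_cong simp: c_def d_def of_nat_diff algebra_simps)
    finally have "- (b * D \<chi> (t - 1)) = (-1) ^ h * row_det n (c(h := \<chi> t))" by simp
    \<comment> \<open>The sign of the scaling turns \<open>(-1) ^ h\<close> into the sign found for
      \<open>\<psi>\<close>, so the two signs cancel in the product.\<close>
    moreover have "(-1 :: 'a) ^ h = - ((-1) ^ (h - 1))"
      using h by (cases h) auto
    ultimately show ?thesis by simp
  qed
  have "row_det n c * ((1 + a * b) * D f t)
      = D \<chi> t * D \<psi> t + row_det n (c(h := \<chi> t)) * row_det n (c(0 := c h, h := \<psi> p))"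
    unfolding Df D\<psi> D\<chi> using h by (intro row_det_pluecker) auto
  moreover have "(a * D \<psi> (t + 1)) * (b * D \<chi> (t - 1))
      = row_det n (c(h := \<chi> t)) * row_det n (c(0 := c h, h := \<psi> p))"
  proof -
    have "((-1 :: 'a) ^ (h - 1)) * ((-1) ^ (h - 1)) = 1"
      by (simp flip: power_mult_distrib)
    then show ?thesis
      unfolding D\<psi>1 D\<chi>1 by (simp add: algebra_simps)
  qed
  ultimately show ?thesis by (simp add: Dc algebra_simps)
qed

section \<open>The prefactor of \<open>tau\<close> under unit shifts\<close>

lemma indefinite_product_nonzero:
  assumes "indefinite_product g G" and "\<And>j. g j \<noteq> 0"
  shows "G l \<noteq> 0"
proof -
  obtain l0 where l0: "G l0 \<noteq> 0" using assms by (auto simp: indefinite_product_def)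
  have step: "G (x + 1) = 0 \<longleftrightarrow> G x = 0" for x
    using assms by (auto simp: indefinite_product_def)
  show ?thesis
  proof (induction l rule: int_induct[where k = l0])
    case (step2 i)
    then show ?case using step[of "i - 1"] by simp
  qed (use l0 step in auto)
qed

definition tau_factor ::
  "(3 \<Rightarrow> int \<Rightarrow> complex) \<Rightarrow> (3 \<Rightarrow> int \<Rightarrow> complex) \<Rightarrow> complex \<Rightarrow> lattice_fun" where
  "tau_factor P Q b l m s =
     (\<Prod>k\<in>UNIV. P k (l k) powi m * Q k (l k) powi s) * b powi (- (m * s))"

lemma tau_factor_shift_l:
  assumes "P i (l i + 1) = x * P i (l i)" "Q i (l i + 1) = y * Q i (l i)"
  shows "tau_factor P Q b (l(i := l i + 1)) m s = x powi m * y powi s * tau_factor P Q b l m s"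
  by (simp add: tau_factor_def prod.remove[of UNIV i] assms power_int_mult_distrib mult_ac
      cong: prod.cong_simp)

lemma tau_factor_shift_m:
  assumes "b \<noteq> 0" "\<And>k. P k (l k) \<noteq> 0"
  shows "tau_factor P Q b l (m + 1) s
    = (\<Prod>k\<in>UNIV. P k (l k)) * b powi (- s) * tau_factor P Q b l m s"
proof -
  have "b powi (- ((m + 1) * s)) = b powi (- s) * b powi (- (m * s))"
    using assms by (simp add: power_int_add[symmetric] algebra_simps)
  then show ?thesis
    using assms by (simp add: tau_factor_def power_int_add prod.distrib mult_ac)
qed

lemma tau_factor_shift_s:
  assumes "b \<noteq> 0" "\<And>k. Q k (l k) \<noteq> 0"
  shows "tau_factor P Q b l m (s + 1)
    = (\<Prod>k\<in>UNIV. Q k (l k)) * b powi (- m) * tau_factor P Q b l m s"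
proof -
  have "b powi (- (m * (s + 1))) = b powi (- m) * b powi (- (m * s))"
    using assms by (simp add: power_int_add[symmetric] algebra_simps)
  then show ?thesis
    using assms by (simp add: tau_factor_def power_int_add prod.distrib mult_ac)
qed

section \<open>From Casorati determinants to \<open>tau\<close>\<close>

theorem theorem2p3:
  fixes N :: nat
    and a P Q :: "3 \<Rightarrow> int \<Rightarrow> complex"
    and b :: complex
    and \<phi> :: "nat \<Rightarrow> (3 \<Rightarrow> int) \<Rightarrow> int \<Rightarrow> int \<Rightarrow> complex"
  assumes "N \<ge> 1"
    and "b \<noteq> 0"
    and "\<And>k j. a k j \<noteq> 0"
    and "\<And>k j. 1 + a k j * b \<noteq> 0"
    and "\<And>i k l m s. i \<in> {1..N} \<Longrightarrow>
           (\<phi> i l m s - \<phi> i (l(k := l k - 1)) m s) / a k (l k - 1) = \<phi> i l m (s + 1)"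
    and "\<And>i l m s. i \<in> {1..N} \<Longrightarrow>
           (\<phi> i l m s - \<phi> i l (m - 1) s) / b = - \<phi> i l m (s - 1)"
    and "\<And>k. indefinite_product (\<lambda>j. 1 + a k j * b) (P k)"
    and "\<And>k. indefinite_product (a k) (Q k)"
  defines "\<tau> \<equiv> tau N P Q b \<phi>"
  shows "\<forall>i l m s.
    \<tau> (l(i := l i + 1)) (m + 1) s * \<tau> l m s - \<tau> (l(i := l i + 1)) m s * \<tau> l (m + 1) s
      = \<tau> (l(i := l i + 1)) m (s + 1) * \<tau> l (m + 1) (s - 1)"
proof (intro allI)
  fix i :: 3 and l :: "3 \<Rightarrow> int" and m s :: int
  let ?l = "l(i := l i + 1)"
  define \<alpha> where "\<alpha> = a i (l i)"
  \<comment> \<open>The relations express values at lower \<open>l\<close> and \<open>m\<close>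
    through higher ones, so everything is written in terms of the corner where both are
    raised.\<close>
  define f where "f = (\<lambda>t j. \<phi> (Suc j) ?l (m + 1) t)"
  have l_rel: "\<phi> (Suc j) l m' t = \<phi> (Suc j) ?l m' t - \<alpha> * \<phi> (Suc j) ?l m' (t + 1)"
    if "j < N" for j m' t
    using assms(5)[of "Suc j" ?l m' t i] assms(3)[of i "l i"] that
    by (simp add: \<alpha>_def field_simps)
  have m_rel: "\<phi> (Suc j) l' m t = \<phi> (Suc j) l' (m + 1) t + b * \<phi> (Suc j) l' (m + 1) (t - 1)"
    if "j < N" for j l' t
    using assms(6)[of "Suc j" l' "m + 1" t] assms(2) that
    by (simp add: field_simps)
  let ?\<sigma> = "casorati N \<phi>"
  have \<sigma>: "(1 + \<alpha> * b) * ?\<sigma> ?l (m + 1) s * ?\<sigma> l m s - ?\<sigma> ?l m s * ?\<sigma> l (m + 1) s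
      = \<alpha> * b * ?\<sigma> ?l m (s + 1) * ?\<sigma> l (m + 1) (s - 1)"
  proof -
    have 1: "?\<sigma> ?l (m + 1) x = row_det N (\<lambda>j. f (x + int j))" for x
      by (simp add: casorati_eq_row_det f_def)
    have 2: "?\<sigma> ?l m x = row_det N (\<lambda>j i. f (x + int j) i + b * f (x + int j - 1) i)" for x
      unfolding casorati_eq_row_det by (rule row_det_cong) (simp add: f_def m_rel)
    have 3: "?\<sigma> l (m + 1) x = row_det N (\<lambda>j i. f (x + int j) i - \<alpha> * f (x + int j + 1) i)" for x
      unfolding casorati_eq_row_det by (rule row_det_cong) (simp add: f_def l_rel)
    \<comment> \<open>The unsimplified shift \<open>- 1 + 1\<close> matches the unfolded form of
      \<open>casorati_bilinear\<close>.\<close>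
    have 4: "?\<sigma> l m x = row_det N (\<lambda>j i. (f (x + int j) i - \<alpha> * f (x + int j + 1) i)
        + b * (f (x + int j - 1) i - \<alpha> * f (x + int j - 1 + 1) i))" for x
      unfolding casorati_eq_row_det
      by (rule row_det_cong) (simp add: f_def l_rel m_rel algebra_simps)
    show ?thesis
      unfolding 1 2 3 4 by (rule casorati_bilinear) (fact assms(1))
  qed
  let ?c = "tau_factor P Q b"
  have \<tau>: "\<tau> l' m' s' = ?c l' m' s' * ?\<sigma> l' m' s'" for l' m' s'
    by (simp add: \<tau>_def tau_def tau_factor_def)
  have P: "P k j \<noteq> 0" and Q: "Q k j \<noteq> 0" for k j
    using indefinite_product_nonzero[OF assms(7)] indefinite_product_nonzero[OF assms(8)]
      assms(3,4) by blast+
  have \<alpha>: "\<alpha> \<noteq> 0" "1 + \<alpha> * b \<noteq> 0"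
    using assms(3,4) by (simp_all add: \<alpha>_def)
  define X where "X = (1 + \<alpha> * b) powi m * \<alpha> powi s"
  define p where "p = (\<Prod>k\<in>UNIV. P k (l k)) * b powi (- s)"
  define q where "q = (\<Prod>k\<in>UNIV. Q k (l k)) * b powi (- m)"
  have shift_l: "?c ?l m' s' = (1 + \<alpha> * b) powi m' * \<alpha> powi s' * ?c l m' s'" for m' s'
    using assms(7)[of i] assms(8)[of i]
    by (intro tau_factor_shift_l) (auto simp: indefinite_product_def \<alpha>_def)
  have c1: "?c ?l m s = X * ?c l m s"
    by (simp add: shift_l X_def)
  have c2: "?c l (m + 1) s = p * ?c l m s"
    by (simp add: tau_factor_shift_m assms(2) P p_def)
  have c3: "?c ?l (m + 1) s = (1 + \<alpha> * b) * X * p * ?c l m s"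
    using \<alpha> by (simp add: shift_l c2 X_def power_int_add)
  have c4: "?c ?l m (s + 1) = \<alpha> * X * q * ?c l m s"
    using \<alpha> by (simp add: shift_l X_def power_int_add tau_factor_shift_s assms(2) Q q_def)
  \<comment> \<open>Multiplying by \<open>q\<close> avoids a division. Raising \<open>s\<close> at
    \<open>m + 1\<close> contributes b^(-m-1), whereas \<open>q\<close> has b^(-m); the surplus is
    the \<open>b\<close> in the coefficient \<open>\<alpha> * b\<close>.\<close>
  have c5: "q * ?c l (m + 1) (s - 1) = b * p * ?c l m s"
  proof -
    have "b powi (- m) = b * b powi (- (m + 1))"
      using power_int_add[of b 1 "- (m + 1)"] assms(2) by simp
    then show ?thesis
      using tau_factor_shift_s[of b Q l P "m + 1" "s - 1"] assms(2) Q c2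
      by (simp add: q_def)
  qed
  have "\<tau> ?l m (s + 1) * \<tau> l (m + 1) (s - 1)
      = \<alpha> * X * ?c l m s * (q * ?c l (m + 1) (s - 1)) * (?\<sigma> ?l m (s + 1) * ?\<sigma> l (m + 1) (s - 1))"
    by (simp add: \<tau> c4)
  also have "\<dots> = X * p * ?c l m s * ?c l m s
      * (\<alpha> * b * ?\<sigma> ?l m (s + 1) * ?\<sigma> l (m + 1) (s - 1))"
    by (simp add: c5)
  also have "\<dots> = \<tau> ?l (m + 1) s * \<tau> l m s - \<tau> ?l m s * \<tau> l (m + 1) s"
    unfolding \<sigma>[symmetric] \<tau> c1 c2 c3 by (simp add: algebra_simps)
  finally show "\<tau> ?l (m + 1) s * \<tau> l m s - \<tau> ?l m s * \<tau> l (m + 1) s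
      = \<tau> ?l m (s + 1) * \<tau> l (m + 1) (s - 1)" ..
qed

end
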